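(* Let $D$ be a weighted oriented graph such that every edge of $D$ is incident to a vertex of degree $2$. Then the toric ideal $I_D$ is strongly robust.
   Context: A weighted oriented graph is a triple $D=(V(D),E(D),w)$, where $V(D)=\{x_1,\ldots,x_n\}$ is a finite vertex set, $E(D)$ is a set of directed edges $(x_i,x_j)$ (directed from $x_i$ to $x_j$) whose underlying undirected graph has no loops and no multiple edges, and $w$ assigns to each vertex $x_j$ a positive integer weight $w_j=w(x_j)$. The degree of a vertex is the number of edges incident to it, inward or outward. Let $K$ be a field. The edge ideal of $D$ is $I(D)=(x_ix_j^{w_j} : (x_i,x_j)\in E(D))\subset K[x_1,\ldots,x_n]$. Writing $E(D)=\{e_1,\ldots,e_m\}$ and regarding the edges also as variables, the toric ideal $I_D$ is the kernel of the $K$-algebra homomorphism $K[e_1,\ldots,e_m]\to K[x_1,\ldots,x_n]$ sending the edge $(x_i,x_j)$ to $x_ix_j^{w_j}$. A nonzero binomial $\mathbf{e}^{\mathbf{u}}-\mathbf{e}^{\mathbf{v}}$ in a toric ideal $I$ is primitive if there is no other nonzero binomial $\mathbf{e}^{\mathbf{u}'}-\mathbf{e}^{\mathbf{v}'}\in I$ with $\mathbf{e}^{\mathbf{u}'}\mid\mathbf{e}^{\mathbf{u}}$ and $\mathbf{e}^{\mathbf{v}'}\mid\mathbf{e}^{\mathbf{v}}$. The Graver basis of $I$ is the set of all primitive binomials of $I$, where $f$ and $-f$ are identified. The toric ideal $I$ is strongly robust if its Graver basis is a minimal generating set of $I$ (equivalently, if the Graver basis equals the set of indispensable binomials of $I$,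 i.e. binomials $f\in I$ such that every system of binomial generators of $I$ contains $f$ or $-f$). *)

theory Defs
  imports
    "HOL-Library.Poly_Mapping"
    "HOL-Algebra.Ideal"
    "HOL-Algebra.RingHom"
    "Graph_Theory.Pair_Digraph"
begin

section \<open>Polynomial rings on a set of variables\<close>

type_synonym ('x, 'k) mpoly = "('x \<Rightarrow>\<^sub>0 nat) \<Rightarrow>\<^sub>0 'k"

definition monomial :: "('x \<Rightarrow>\<^sub>0 nat) \<Rightarrow> ('x, 'k::field) mpoly" where
  "monomial u = Poly_Mapping.single u 1"

definition Const :: "'k \<Rightarrow> ('x, 'k::field) mpoly" where
  "Const c = Poly_Mapping.single 0 c"

definition Var :: "'x \<Rightarrow> ('x, 'k::field) mpoly" where
  "Var x = monomial (Poly_Mapping.single x 1)"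

text \<open>The ring \<open>K[X]\<close> on the set \<open>X\<close> of variables, where \<open>K\<close> is the type \<open>'k\<close>.\<close>

definition poly_ring :: "'x set \<Rightarrow> ('x, 'k::field) mpoly ring" where
  "poly_ring X =
     \<lparr> carrier = {p. \<forall>m \<in> Poly_Mapping.keys p. Poly_Mapping.keys m \<subseteq> X},
       monoid.mult = (*), one = 1, zero = 0, add = (+) \<rparr>"

definition subst_poly :: "('x \<Rightarrow> ('y, 'k::field) mpoly) \<Rightarrow> ('x, 'k) mpoly \<Rightarrow> ('y, 'k) mpoly" where
  "subst_poly f p =
     (\<Sum>m\<in>Poly_Mapping.keys p. Const (Poly_Mapping.lookup p m) *
        (\<Prod>x\<in>Poly_Mapping.keys m. f x ^ Poly_Mapping.lookup m x))"


section \<open>Weighted oriented graphs and their toric ideals\<close>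

text \<open>Together with loop-freeness (part of \<^locale>\<open>pair_digraph\<close>), \<open>no_antiparallel\<close> says that the
  underlying undirected graph is simple.\<close>

locale weighted_oriented_graph = pair_digraph D for D :: "'v pair_pre_digraph" +
  fixes w :: "'v \<Rightarrow> nat"
  assumes no_antiparallel: "(x, y) \<in> parcs D \<Longrightarrow> (y, x) \<notin> parcs D"
    and weight_pos: "x \<in> pverts D \<Longrightarrow> 0 < w x"

definition vertex_degree :: "'v pair_pre_digraph \<Rightarrow> 'v \<Rightarrow> nat" where
  "vertex_degree D x = in_degree (with_proj D) x + out_degree (with_proj D) x"

definition edge_monomial :: "('v \<Rightarrow> nat) \<Rightarrow> 'v \<times> 'v \<Rightarrow> ('v, 'k::field) mpoly" where
  "edge_monomial w e = Var (fst e) * Var (snd e) ^ w (snd e)"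

definition toric_ideal :: "'v pair_pre_digraph \<Rightarrow> ('v \<Rightarrow> nat) \<Rightarrow> ('v \<times> 'v, 'k::field) mpoly set" where
  "toric_ideal D w =
     a_kernel (poly_ring (parcs D)) (poly_ring (pverts D))
       (subst_poly (edge_monomial w :: _ \<Rightarrow> ('v, 'k) mpoly))"


section \<open>Graver bases and strong robustness\<close>

definition primitive_binomial :: "('x, 'k::field) mpoly set \<Rightarrow> ('x, 'k) mpoly \<Rightarrow> bool" where
  "primitive_binomial I f \<longleftrightarrow>
     (\<exists>u v. f = monomial u - monomial v \<and> f \<in> I \<and> f \<noteq> 0 \<and>
       (\<forall>g u' v'. g = monomial u' - monomial v' \<and> g \<in> I \<and> g \<noteq> 0 \<and>
            (monomial u' :: ('x, 'k) mpoly) dvd monomial u \<and> (monomial v' :: ('x, 'k) mpoly) dvd monomial v \<longrightarrow>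
          g = f))"

text \<open>Identifying \<open>f\<close> with \<open>-f\<close> amounts to choosing one of the two for every primitive \<open>f\<close>;
  the Graver basis is determined up to this choice.\<close>

definition graver_basis :: "('x, 'k::field) mpoly set \<Rightarrow> ('x, 'k) mpoly set \<Rightarrow> bool" where
  "graver_basis I S \<longleftrightarrow>
     (\<forall>f\<in>S. primitive_binomial I f) \<and>
     (\<forall>f. primitive_binomial I f \<longrightarrow> (\<exists>!g. g \<in> S \<and> (g = f \<or> g = - f)))"

definition minimal_generating_set :: "('a, 'm) ring_scheme \<Rightarrow> 'a set \<Rightarrow> 'a set \<Rightarrow> bool" where
  "minimal_generating_set R I S \<longleftrightarrow>
     S \<subseteq> carrier R \<and> Idl\<^bsub>R\<^esub> S = I \<and> (\<forall>T. T \<subset> S \<longrightarrow> Idl\<^bsub>R\<^esub> T \<noteq> I)"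

text \<open>The quantifier over the choices of signs is not vacuous, see \<open>graver_basis_exists\<close> below.\<close>

definition strongly_robust :: "'x set \<Rightarrow> ('x, 'k::field) mpoly set \<Rightarrow> bool" where
  "strongly_robust X I \<longleftrightarrow>
     (\<forall>S. graver_basis I S \<longrightarrow> minimal_generating_set (poly_ring X) I S)"


section \<open>Consistency of the definitions\<close>

lemma poly_ring_simps [simp]:
  "monoid.mult (poly_ring X) = (*)" "one (poly_ring X) = 1"
  "zero (poly_ring X) = 0" "add (poly_ring X) = (+)"
  by (simp_all add: poly_ring_def)

lemma carrier_poly_ring:
  "p \<in> carrier (poly_ring X) \<longleftrightarrow> (\<forall>m\<in>Poly_Mapping.keys p. Poly_Mapping.keys m \<subseteq> X)"
  by (simp add: poly_ring_def)

lemma poly_ring_add_closed: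
  assumes "p \<in> carrier (poly_ring X)" "q \<in> carrier (poly_ring X)"
  shows "p + q \<in> carrier (poly_ring X)"
  using assms keys_add[of p q] unfolding carrier_poly_ring by blast

lemma poly_ring_mult_closed:
  assumes "p \<in> carrier (poly_ring X)" "q \<in> carrier (poly_ring X)"
  shows "p * q \<in> carrier (poly_ring X)"
  unfolding carrier_poly_ring
proof
  fix m assume "m \<in> Poly_Mapping.keys (p * q)"
  then obtain a b where ab: "a \<in> Poly_Mapping.keys p" "b \<in> Poly_Mapping.keys q" "m = a + b"
    using keys_mult[of p q] by blast
  then show "Poly_Mapping.keys m \<subseteq> X"
    using assms keys_add[of a b] unfolding carrier_poly_ring by blast
qed

lemma poly_ring_zero_closed: "0 \<in> carrier (poly_ring X)"
  by (simp add: carrier_poly_ring)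

lemma poly_ring_one_closed: "1 \<in> carrier (poly_ring X)"
  by (simp add: carrier_poly_ring)

lemma poly_ring_Const_closed: "Const c \<in> carrier (poly_ring X)"
  by (simp add: carrier_poly_ring Const_def)

lemma poly_ring_Var_closed: "x \<in> X \<Longrightarrow> Var x \<in> carrier (poly_ring X)"
  by (simp add: carrier_poly_ring Var_def monomial_def)

lemma poly_ring_uminus_closed: "p \<in> carrier (poly_ring X) \<Longrightarrow> - p \<in> carrier (poly_ring X)"
  by (simp add: carrier_poly_ring)

lemma poly_ring_power_closed: "p \<in> carrier (poly_ring X) \<Longrightarrow> p ^ n \<in> carrier (poly_ring X)"
  by (induction n) (auto simp: poly_ring_one_closed poly_ring_mult_closed)

lemma poly_ring_sum_closed:
  "(\<And>i. i \<in> A \<Longrightarrow> h i \<in> carrier (poly_ring X)) \<Longrightarrow> sum h A \<in> carrier (poly_ring X)"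
  by (induction A rule: infinite_finite_induct)
    (auto simp: poly_ring_zero_closed poly_ring_add_closed)

lemma poly_ring_prod_closed:
  "(\<And>i. i \<in> A \<Longrightarrow> h i \<in> carrier (poly_ring X)) \<Longrightarrow> prod h A \<in> carrier (poly_ring X)"
  by (induction A rule: infinite_finite_induct)
    (auto simp: poly_ring_one_closed poly_ring_mult_closed)

lemma cring_poly_ring: "cring (poly_ring X :: ('x, 'k::field) mpoly ring)"
proof (rule cringI)
  show "abelian_group (poly_ring X :: ('x, 'k) mpoly ring)"
  proof (rule abelian_groupI, goal_cases)
    case (6 p)
    then show ?case
      by (intro bexI[of _ "- p"]) (auto simp: poly_ring_uminus_closed)
  qed (auto simp: poly_ring_add_closed poly_ring_zero_closed algebra_simps)
  show "Group.comm_monoid (poly_ring X :: ('x, 'k) mpoly ring)"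
    by (rule comm_monoidI)
      (auto simp: poly_ring_mult_closed poly_ring_one_closed algebra_simps)
qed (auto simp: algebra_simps)

lemma Const_mult: "Const (a * b) = Const a * Const b"
  by (simp add: Const_def mult_single)

lemma Const_add: "Const (a + b) = Const a + Const b"
  by (simp add: Const_def single_add)

lemma Const_0 [simp]: "Const 0 = 0"
  by (simp add: Const_def)

lemma Const_1 [simp]: "Const 1 = 1"
  by (simp add: Const_def)

lemma subst_poly_superset:
  assumes "finite A" "Poly_Mapping.keys p \<subseteq> A"
  shows "subst_poly f p =
    (\<Sum>m\<in>A. Const (Poly_Mapping.lookup p m) *
        (\<Prod>x\<in>Poly_Mapping.keys m. f x ^ Poly_Mapping.lookup m x))"
  unfolding subst_poly_def
  by (rule sum.mono_neutral_left) (use assms in \<open>auto simp: in_keys_iff\<close>)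

lemma subst_poly_add: "subst_poly f (p + q) = subst_poly f p + subst_poly f q"
proof -
  let ?A = "Poly_Mapping.keys p \<union> Poly_Mapping.keys q"
  have "Poly_Mapping.keys (p + q) \<subseteq> ?A" by (rule keys_add)
  then show ?thesis
    by (simp add: subst_poly_superset[of ?A] lookup_add Const_add distrib_right sum.distrib)
qed

lemma subst_poly_0 [simp]: "subst_poly f 0 = 0"
  by (simp add: subst_poly_def)

lemma subst_poly_sum: "subst_poly f (sum h A) = (\<Sum>i\<in>A. subst_poly f (h i))"
  by (induction A rule: infinite_finite_induct) (auto simp: subst_poly_add)

lemma subst_poly_single:
  "subst_poly f (Poly_Mapping.single m c) =
     Const c * (\<Prod>x\<in>Poly_Mapping.keys m. f x ^ Poly_Mapping.lookup m x)"
  by (simp add: subst_poly_def)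

lemma monomial_value_superset:
  assumes "finite A" "Poly_Mapping.keys m \<subseteq> A"
  shows "(\<Prod>x\<in>Poly_Mapping.keys m. f x ^ Poly_Mapping.lookup m x) =
    (\<Prod>x\<in>A. (f x :: 'a::comm_monoid_mult) ^ Poly_Mapping.lookup m x)"
  by (rule prod.mono_neutral_left) (use assms in \<open>auto simp: in_keys_iff\<close>)

lemma subst_poly_mult_single:
  "subst_poly f (Poly_Mapping.single a c * Poly_Mapping.single b d) =
     subst_poly f (Poly_Mapping.single a c) * subst_poly f (Poly_Mapping.single b d)"
proof -
  let ?A = "Poly_Mapping.keys a \<union> Poly_Mapping.keys b"
  let ?v = "\<lambda>m. \<Prod>x\<in>Poly_Mapping.keys m. f x ^ Poly_Mapping.lookup m x"
  have "Poly_Mapping.keys (a + b) \<subseteq> ?A" by (rule keys_add)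
  then have "?v (a + b) = (\<Prod>x\<in>?A. f x ^ Poly_Mapping.lookup (a + b) x)"
    by (intro monomial_value_superset) auto
  also have "\<dots> = (\<Prod>x\<in>?A. f x ^ Poly_Mapping.lookup a x) * (\<Prod>x\<in>?A. f x ^ Poly_Mapping.lookup b x)"
    by (simp add: lookup_add power_add prod.distrib)
  also have "\<dots> = ?v a * ?v b"
    by (simp add: monomial_value_superset[of ?A])
  finally show ?thesis
    by (simp only: mult_single subst_poly_single Const_mult mult_ac)
qed

lemma mpoly_expand:
  "p = (\<Sum>m\<in>Poly_Mapping.keys p. Poly_Mapping.single m (Poly_Mapping.lookup p m))"
  by (rule poly_mapping_eqI) (simp add: lookup_sum lookup_single when_def in_keys_iff)

lemma subst_poly_mult: "subst_poly f (p * q) = subst_poly f p * subst_poly f q"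
proof -
  let ?s = "\<lambda>p m. Poly_Mapping.single m (Poly_Mapping.lookup p m)"
  have "subst_poly f (p * q) = subst_poly f
      ((\<Sum>a\<in>Poly_Mapping.keys p. ?s p a) * (\<Sum>b\<in>Poly_Mapping.keys q. ?s q b))"
    using mpoly_expand[of p] mpoly_expand[of q] by simp
  also have "\<dots> = subst_poly f (\<Sum>a\<in>Poly_Mapping.keys p. ?s p a) *
      subst_poly f (\<Sum>b\<in>Poly_Mapping.keys q. ?s q b)"
    by (simp only: sum_product subst_poly_sum subst_poly_mult_single)
  also have "\<dots> = subst_poly f p * subst_poly f q"
    using mpoly_expand[of p] mpoly_expand[of q] by simp
  finally show ?thesis .
qed

lemma subst_poly_Const: "subst_poly f (Const c) = Const c"
  by (simp add: Const_def subst_poly_single)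

lemma subst_poly_1: "subst_poly f 1 = 1"
  using subst_poly_Const[of f 1] by simp

lemma subst_poly_Var: "subst_poly f (Var x) = f x"
  by (simp add: Var_def monomial_def subst_poly_single)

lemma subst_poly_closed:
  assumes "\<And>x. x \<in> X \<Longrightarrow> f x \<in> carrier (poly_ring Y)" "p \<in> carrier (poly_ring X)"
  shows "subst_poly f p \<in> carrier (poly_ring Y)"
  unfolding subst_poly_def
proof (intro poly_ring_sum_closed poly_ring_mult_closed poly_ring_Const_closed
    poly_ring_prod_closed poly_ring_power_closed)
  fix m x assume "m \<in> Poly_Mapping.keys p" "x \<in> Poly_Mapping.keys m"
  then show "f x \<in> carrier (poly_ring Y)"
    using assms unfolding carrier_poly_ring[of p] by blast
qed

lemma (in weighted_oriented_graph) toric_hom: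
  "ring_hom_cring (poly_ring (parcs D)) (poly_ring (pverts D))
     (subst_poly (edge_monomial w :: _ \<Rightarrow> ('v, 'k::field) mpoly))"
proof -
  have cl: "(edge_monomial w e :: ('v, 'k) mpoly) \<in> carrier (poly_ring (pverts D))"
    if "e \<in> parcs D" for e
    using that arc_fst_in_verts[of e] arc_snd_in_verts[of e] unfolding edge_monomial_def
    by (intro poly_ring_mult_closed poly_ring_power_closed poly_ring_Var_closed)
  show ?thesis
    by (intro ring_hom_cring.intro ring_hom_cring_axioms.intro cring_poly_ring ring_hom_memI)
      (auto intro: subst_poly_closed cl simp: subst_poly_mult subst_poly_add subst_poly_1)
qed

lemma toric_ideal_iff:
  "p \<in> toric_ideal D w \<longleftrightarrow>
     p \<in> carrier (poly_ring (parcs D)) \<and> subst_poly (edge_monomial w) p = 0"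
  by (simp add: toric_ideal_def a_kernel_def' )

lemma (in weighted_oriented_graph) toric_ideal_ideal:
  "ideal (toric_ideal D w :: ('v \<times> 'v, 'k::field) mpoly set) (poly_ring (parcs D))"
proof -
  interpret ring_hom_cring "poly_ring (parcs D)" "poly_ring (pverts D)"
    "subst_poly (edge_monomial w :: _ \<Rightarrow> ('v, 'k) mpoly)" by (rule toric_hom)
  show ?thesis unfolding toric_ideal_def by (rule ring.kernel_is_ideal)
qed

lemma primitive_binomial_uminus:
  assumes "\<And>f. f \<in> I \<Longrightarrow> - f \<in> I" "primitive_binomial I f"
  shows "primitive_binomial I (- f)"
proof -
  obtain u v where f: "f = monomial u - monomial v" "f \<in> I" "f \<noteq> 0"
    and min: "\<And>g u' v'. g = monomial u' - monomial v' \<Longrightarrow> g \<in> I \<Longrightarrow> g \<noteq> 0 \<Longrightarrow>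
      (monomial u' :: ('a, 'b) mpoly) dvd monomial u \<Longrightarrow> (monomial v' :: ('a, 'b) mpoly) dvd monomial v \<Longrightarrow>
      g = f"
    using assms(2) unfolding primitive_binomial_def by blast
  show ?thesis unfolding primitive_binomial_def
  proof (rule exI[of _ v], rule exI[of _ u], intro conjI allI impI)
    fix g u' v'
    assume "g = monomial u' - monomial v' \<and> g \<in> I \<and> g \<noteq> 0 \<and>
      (monomial u' :: ('a, 'b) mpoly) dvd monomial v \<and> (monomial v' :: ('a, 'b) mpoly) dvd monomial u"
    then have "- g = f"
      using assms(1)[of g] by (intro min[of _ v' u']) auto
    then show "g = - f" by (metis minus_minus)
  qed (use f assms(1)[OF f(2)] in auto)
qed

lemma graver_basis_exists:
  assumes "\<And>f. f \<in> I \<Longrightarrow> - f \<in> I"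
  shows "\<exists>S. graver_basis I S"
proof -
  define r where "r = (\<lambda>f :: ('a, 'b) mpoly. SOME g. g \<in> {f, - f})"
  have r: "r f = f \<or> r f = - f" for f
    using someI[of "\<lambda>g. g \<in> {f, - f}" f] by (simp add: r_def)
  have r_minus: "r (- f) = r f" for f
    by (simp only: r_def minus_minus insert_commute)
  have "graver_basis I (r ` {f. primitive_binomial I f})"
    unfolding graver_basis_def
  proof (intro conjI ballI allI impI)
    fix g assume "g \<in> r ` {f. primitive_binomial I f}"
    then show "primitive_binomial I g"
      using r primitive_binomial_uminus[OF assms] by (metis imageE mem_Collect_eq)
  next
    fix f assume f: "primitive_binomial I f"
    show "\<exists>!g. g \<in> r ` {f. primitive_binomial I f} \<and> (g = f \<or> g = - f)"
    proof (intro ex1I[of _ "r f"] conjI r)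
      show "r f \<in> r ` {f. primitive_binomial I f}" using f by blast
    next
      fix g assume g: "g \<in> r ` {f. primitive_binomial I f} \<and> (g = f \<or> g = - f)"
      then obtain h where "g = r h" by blast
      then have "r g = g" using r[of h] r_minus[of h] by metis
      moreover have "r g = r f" using g r_minus by metis
      ultimately show "g = r f" by simp
    qed
  qed
  then show ?thesis by blast
qed

end

theory Submission
  imports Defs
begin

text \<open>At a vertex of degree two with edges \<open>e\<close>, \<open>f\<close> every vector of the kernel lattice has entries of
  opposite signs in \<open>e\<close> and \<open>f\<close> (or zero in both). Hence a semiconformal decomposition of a lattice
  vector is automatically conformal: a coordinate \<open>e\<close> violating conformality would make its partner \<open>f\<close>
  violate semiconformality. So if a term of a primitive binomial \<open>t\<close> divides a term of a primitive
  binomial \<open>f\<close>, the other terms divide each other as well and \<open>t = \<plusminus>f\<close>. Therefore the monomials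
  not dividing a given term of \<open>f\<close> span an ideal that contains all Graver elements
  other than \<open>\<plusminus>f\<close>, and \<open>f\<close> cannot be omitted.\<close>

section \<open>Monomials and binomials\<close>

lemma monomial_add: "monomial (u + v) = monomial u * monomial v"
  by (simp add: monomial_def mult_single)

lemma monomial_0 [simp]: "monomial 0 = 1"
  by (simp add: monomial_def)

lemma keys_monomial [simp]: "Poly_Mapping.keys (monomial u :: ('x, 'k::field) mpoly) = {u}"
  by (simp add: monomial_def)

lemma monomial_inject [simp]: "(monomial u :: ('x, 'k::field) mpoly) = monomial v \<longleftrightarrow> u = v"
  by (metis keys_monomial singleton_inject)

lemma single_eq_Const_mult: "Poly_Mapping.single m c = Const c * monomial m"
  by (simp add: Const_def monomial_def mult_single)

lemma keys_binomial:
  "u \<noteq> v \<Longrightarrow> Poly_Mapping.keys (monomial u - monomial v :: ('x, 'k::field) mpoly) = {u, v}"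
  by (auto simp: monomial_def in_keys_iff lookup_minus lookup_single when_def split: if_splits)

lemma single_sum: "Poly_Mapping.single m (sum c A) = (\<Sum>i\<in>A. Poly_Mapping.single m (c i))"
  by (induction A rule: infinite_finite_induct) (simp_all add: single_add)

text \<open>The cofactor may be any polynomial, but multiplying it by \<open>monomial a\<close>
  shifts all its exponents by \<open>a\<close>; so the key \<open>u\<close> of the product is
  \<open>a\<close> plus an exponent.\<close>

lemma monomial_dvd_iff:
  "(monomial a :: ('x, 'k::field) mpoly) dvd monomial u \<longleftrightarrow> (\<exists>d. u = a + d)"
proof
  assume "(monomial a :: ('x, 'k) mpoly) dvd monomial u"
  then obtain q :: "('x, 'k) mpoly" where "monomial u = monomial a * q" ..
  then have "u \<in> Poly_Mapping.keys (monomial a * q)" by (metis keys_monomial singletonI)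
  then show "\<exists>d. u = a + d"
    using keys_mult[of "monomial a" q] by auto
qed (auto simp: monomial_add)

lemma exponent_le_iff:
  "(\<exists>d. u = a + d) \<longleftrightarrow> (\<forall>x. Poly_Mapping.lookup a x \<le> Poly_Mapping.lookup u x)"
  for u a :: "'x \<Rightarrow>\<^sub>0 nat"
proof
  assume "\<forall>x. Poly_Mapping.lookup a x \<le> Poly_Mapping.lookup u x"
  \<comment> \<open>The subtraction is truncated; the pointwise inequality makes it exact.\<close>
  then have "u = a + (u - a)"
    by (intro poly_mapping_eqI) (simp add: lookup_add lookup_minus)
  then show "\<exists>d. u = a + d" ..
qed (auto simp: lookup_add)

text \<open>A divisor of a divisor of \<open>u\<close> divides \<open>u\<close>, so multiples of
  non-divisors are non-divisors. These ideals later separate one Graver element, with term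
  \<open>u\<close>, from all the others.\<close>

lemma monomial_ideal:
  "ideal {p \<in> carrier (poly_ring X). \<forall>m\<in>Poly_Mapping.keys p. \<not> (\<exists>d. u = m + d)}
     (poly_ring X :: ('x, 'k::field) mpoly ring)" (is "ideal ?J ?R")
proof -
  interpret cring ?R by (rule cring_poly_ring)
  have mult: "q * p \<in> ?J" if p: "p \<in> ?J" and q: "q \<in> carrier ?R" for p q
  proof -
    have "\<not> (\<exists>d. u = m + d)" if m: "m \<in> Poly_Mapping.keys (q * p)" for m
    proof
      assume "\<exists>d. u = m + d"
      moreover obtain a b where b: "b \<in> Poly_Mapping.keys p" "m = a + b"
        using keys_mult[of q p] m by blast
      ultimately obtain d where "u = b + (a + d)" by (auto simp: ac_simps)
      then show False using p b(1) by blast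
    qed
    then show ?thesis using p q poly_ring_mult_closed[of q X p] by blast
  qed
  have uminus: "\<ominus>\<^bsub>?R\<^esub> p = - p" if "p \<in> carrier ?R" for p
    using that by (intro minus_equality) (auto intro: poly_ring_uminus_closed)
  have "subgroup ?J (add_monoid ?R)"
  proof (rule add.subgroupI)
    show "\<ominus>\<^bsub>?R\<^esub> p \<in> ?J" if "p \<in> ?J" for p
      using that uminus[of p] by (auto intro: poly_ring_uminus_closed)
    show "p \<oplus>\<^bsub>?R\<^esub> q \<in> ?J" if "p \<in> ?J" "q \<in> ?J" for p q
      using that keys_add[of p q] by (auto intro: poly_ring_add_closed)
  qed (auto intro: poly_ring_zero_closed)
  then show ?thesis
    by (intro idealI ring_axioms) (use mult in \<open>simp_all add: mult.commute\<close>)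
qed

lemma ideal_poly_ringD:
  assumes "ideal J (poly_ring X)"
  shows "0 \<in> J" "p \<in> J \<Longrightarrow> q \<in> J \<Longrightarrow> p + q \<in> J"
    "p \<in> J \<Longrightarrow> r \<in> carrier (poly_ring X) \<Longrightarrow> r * p \<in> J"
  using additive_subgroup.zero_closed[OF ideal.axioms(1)[OF assms]]
    additive_subgroup.a_closed[OF ideal.axioms(1)[OF assms], of p q]
    ideal.I_l_closed[OF assms, of p r] by simp_all

section \<open>The degree map\<close>

text \<open>The exponent vector of the image of \<open>monomial u\<close> under the toric map, i.e.
  the weighted incidence matrix applied to \<open>u\<close>.\<close>

definition toric_degree :: "('v \<Rightarrow> nat) \<Rightarrow> ('v \<times> 'v \<Rightarrow>\<^sub>0 nat) \<Rightarrow> 'v \<Rightarrow>\<^sub>0 nat" where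
  "toric_degree w u = (\<Sum>e\<in>Poly_Mapping.keys u. Poly_Mapping.single (fst e) (Poly_Mapping.lookup u e) +
     Poly_Mapping.single (snd e) (Poly_Mapping.lookup u e * w (snd e)))"

lemma toric_degree_superset:
  assumes "finite A" "Poly_Mapping.keys u \<subseteq> A"
  shows "toric_degree w u = (\<Sum>e\<in>A. Poly_Mapping.single (fst e) (Poly_Mapping.lookup u e) +
     Poly_Mapping.single (snd e) (Poly_Mapping.lookup u e * w (snd e)))"
  unfolding toric_degree_def
  by (rule sum.mono_neutral_left) (use assms in \<open>auto simp: in_keys_iff\<close>)

lemma toric_degree_add: "toric_degree w (u + v) = toric_degree w u + toric_degree w v"
proof -
  let ?A = "Poly_Mapping.keys u \<union> Poly_Mapping.keys v"
  have "Poly_Mapping.keys (u + v) \<subseteq> ?A" by (rule keys_add)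
  then show ?thesis
    by (simp add: toric_degree_superset[of ?A] lookup_add single_add distrib_right sum.distrib add_ac)
qed

text \<open>Row \<open>x\<close> of the incidence matrix. Its weight can be written
  \<open>w x\<close>, since it counts only for edges with head \<open>x\<close>.\<close>

lemma lookup_toric_degree:
  assumes "finite A" "Poly_Mapping.keys u \<subseteq> A"
  shows "Poly_Mapping.lookup (toric_degree w u) x =
    (\<Sum>e\<in>A. Poly_Mapping.lookup u e * (of_bool (fst e = x) + of_bool (snd e = x) * w x))"
  unfolding toric_degree_superset[OF assms] lookup_sum
  by (rule sum.cong) (auto simp: lookup_add lookup_single when_def algebra_simps)

lemma prod_monomial: "(\<Prod>i\<in>A. monomial (g i)) = monomial (\<Sum>i\<in>A. g i)"
  by (induction A rule: infinite_finite_induct) (auto simp: monomial_add)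

lemma Var_power: "Var x ^ n = monomial (Poly_Mapping.single x n)"
  by (induction n) (simp_all add: Var_def flip: monomial_add single_add)

lemma monomial_power: "monomial (Poly_Mapping.single x k) ^ n = monomial (Poly_Mapping.single x (n * k))"
  by (induction n) (simp_all flip: monomial_add single_add)

lemma edge_monomial_power: "edge_monomial w e ^ n =
    monomial (Poly_Mapping.single (fst e) n + Poly_Mapping.single (snd e) (n * w (snd e)))"
  by (simp add: edge_monomial_def power_mult_distrib Var_power monomial_power monomial_add)

lemma subst_poly_edge_monomial:
  "subst_poly (edge_monomial w) p =
     (\<Sum>m\<in>Poly_Mapping.keys p. Poly_Mapping.single (toric_degree w m) (Poly_Mapping.lookup p m))"
  by (simp add: subst_poly_def edge_monomial_power prod_monomial toric_degree_def single_eq_Const_mult)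

lemma subst_poly_edge_monomial_monomial:
  "subst_poly (edge_monomial w) (monomial u) = monomial (toric_degree w u)"
  by (simp add: subst_poly_edge_monomial) (simp add: monomial_def)

lemma subst_poly_diff: "subst_poly f (p - q) = subst_poly f p - subst_poly f q"
  using subst_poly_add[of f "p - q" q] by simp

text \<open>Distinct exponents keep both terms visible as keys, and the two image monomials cancel
  exactly when their degrees agree. For \<open>u = v\<close> the binomial is zero and says nothing
  about keys.\<close>

lemma binomial_in_toric_ideal_iff:
  assumes "u \<noteq> v"
  shows "(monomial u - monomial v :: ('v \<times> 'v, 'k::field) mpoly) \<in> toric_ideal D w \<longleftrightarrow>
    Poly_Mapping.keys u \<subseteq> parcs D \<and> Poly_Mapping.keys v \<subseteq> parcs D \<and>
    toric_degree w u = toric_degree w v"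
  using assms
  by (auto simp: toric_ideal_iff carrier_poly_ring keys_binomial subst_poly_diff
      subst_poly_edge_monomial_monomial)

section \<open>The Graver basis generates\<close>

text \<open>A toric ideal is spanned by its binomials: the coefficients of \<open>p\<close> sum to
  zero on each degree fibre, so one fixed term of the fibre can be subtracted from every term in it
  without changing \<open>p\<close>.\<close>

lemma (in weighted_oriented_graph) toric_ideal_subset:
  assumes J: "ideal J (poly_ring (parcs D) :: ('v \<times> 'v, 'k::field) mpoly ring)"
    and binomials: "\<And>u v. (monomial u - monomial v :: ('v \<times> 'v, 'k) mpoly) \<in> toric_ideal D w \<Longrightarrow>
      monomial u - monomial v \<in> J"
  shows "toric_ideal D w \<subseteq> J"
proof
  fix p :: "('v \<times> 'v, 'k) mpoly" assume p: "p \<in> toric_ideal D w"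
  let ?K = "Poly_Mapping.keys p"
  \<comment> \<open>An arbitrary representative among the terms of \<open>p\<close> of degree
    \<open>d\<close>.\<close>
  define r where "r d = (SOME m. m \<in> ?K \<and> toric_degree w m = d)" for d
  have r: "r (toric_degree w m) \<in> ?K \<and> toric_degree w (r (toric_degree w m)) = toric_degree w m"
    if "m \<in> ?K" for m
    unfolding r_def by (rule someI[of _ m]) (use that in simp)
  have keys: "Poly_Mapping.keys m \<subseteq> parcs D" if "m \<in> ?K" for m
    using p that by (auto simp: toric_ideal_iff carrier_poly_ring)
  have sum_J: "sum h A \<in> J" if "\<And>m. m \<in> A \<Longrightarrow> h m \<in> J" for h and A :: "('v \<times> 'v \<Rightarrow>\<^sub>0 nat) set"
    using that ideal_poly_ringD(1,2)[OF J]
    by (induction A rule: infinite_finite_induct) auto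
  let ?D = "toric_degree w ` ?K"
  let ?c = "\<lambda>d. \<Sum>m\<in>{m \<in> ?K. toric_degree w m = d}. Poly_Mapping.lookup p m"
  \<comment> \<open>This sum is the coefficient at \<open>d\<close> of the image of
    \<open>p\<close>, which is zero.\<close>
  have c0: "?c d = 0" for d
  proof -
    have "0 = Poly_Mapping.lookup (subst_poly (edge_monomial w) p) d"
      using p by (simp add: toric_ideal_iff)
    also have "\<dots> = (\<Sum>m\<in>?K. if toric_degree w m = d then Poly_Mapping.lookup p m else 0)"
      by (simp add: subst_poly_edge_monomial lookup_sum lookup_single when_def)
    also have "\<dots> = ?c d"
      by (simp add: sum.If_cases Int_def)
    finally show ?thesis by simp
  qed
  have "(\<Sum>m\<in>?K. Const (Poly_Mapping.lookup p m) * monomial (r (toric_degree w m)))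
      = (\<Sum>d\<in>?D. \<Sum>m\<in>{m \<in> ?K. toric_degree w m = d}.
          Const (Poly_Mapping.lookup p m) * monomial (r (toric_degree w m)))"
    by (rule sum.image_gen) simp
  also have "\<dots> = (\<Sum>d\<in>?D. Poly_Mapping.single (r d) (?c d))"
    by (intro sum.cong refl) (simp add: single_sum flip: single_eq_Const_mult)
  also have "\<dots> = 0" by (simp add: c0)
  finally have "p = (\<Sum>m\<in>?K. Const (Poly_Mapping.lookup p m) *
      (monomial m - monomial (r (toric_degree w m))))"
    using mpoly_expand[of p] by (simp add: right_diff_distrib sum_subtractf single_eq_Const_mult)
  also have "\<dots> \<in> J"
  proof (rule sum_J)
    fix m assume m: "m \<in> ?K"
    have "monomial m - monomial (r (toric_degree w m)) \<in> J"
    proof (cases "m = r (toric_degree w m)")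
      case True
      then show ?thesis using ideal_poly_ringD(1)[OF J] by simp
    next
      case False
      then show ?thesis
        using m r[OF m] keys by (intro binomials) (auto simp: binomial_in_toric_ideal_iff)
    qed
    then show "Const (Poly_Mapping.lookup p m) * (monomial m - monomial (r (toric_degree w m))) \<in> J"
      using ideal_poly_ringD(3)[OF J _ poly_ring_Const_closed] by blast
  qed
  finally show "p \<in> J" .
qed

section \<open>From primitive to arbitrary binomials, by induction on total degree\<close>

definition exponent_size :: "('x \<Rightarrow>\<^sub>0 nat) \<Rightarrow> nat" where
  "exponent_size u = (\<Sum>x\<in>Poly_Mapping.keys u. Poly_Mapping.lookup u x)"

lemma exponent_size_add: "exponent_size (u + v) = exponent_size u + exponent_size v"
proof -
  let ?A = "Poly_Mapping.keys u \<union> Poly_Mapping.keys v"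
  have superset: "exponent_size m = (\<Sum>x\<in>?A. Poly_Mapping.lookup m x)"
    if "Poly_Mapping.keys m \<subseteq> ?A" for m
    unfolding exponent_size_def
    by (rule sum.mono_neutral_left) (use that in \<open>auto simp: in_keys_iff\<close>)
  have "Poly_Mapping.keys (u + v) \<subseteq> ?A" by (rule keys_add)
  then show ?thesis by (simp add: superset lookup_add sum.distrib)
qed

lemma exponent_size_eq_0_iff: "exponent_size u = 0 \<longleftrightarrow> u = 0"
  by (auto simp: exponent_size_def in_keys_iff) (metis keys_eq_empty lookup_not_eq_zero_eq_in_keys ex_in_conv)

lemma keys_add_nat: "Poly_Mapping.keys (u + v) = Poly_Mapping.keys u \<union> Poly_Mapping.keys v"
  for u v :: "'x \<Rightarrow>\<^sub>0 nat"
  by (auto simp: in_keys_iff lookup_add)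

text \<open>If \<open>a\<close>, \<open>b\<close> witness that the binomial is not primitive and
  \<open>u = a + c\<close>, \<open>v = b + d\<close>, then it equals c(a - b) + b(c - d), letters
  standing for monomials; both brackets are smaller binomials of the toric ideal.\<close>

lemma (in weighted_oriented_graph) binomial_in_ideal_of_primitive:
  assumes J: "ideal J (poly_ring (parcs D) :: ('v \<times> 'v, 'k::field) mpoly ring)"
    and prim: "\<And>f. primitive_binomial (toric_ideal D w :: ('v \<times> 'v, 'k) mpoly set) f \<Longrightarrow> f \<in> J"
    and "(monomial u - monomial v :: ('v \<times> 'v, 'k) mpoly) \<in> toric_ideal D w"
  shows "(monomial u - monomial v :: ('v \<times> 'v, 'k) mpoly) \<in> J"
  using assms(3)
proof (induction "exponent_size u + exponent_size v" arbitrary: u v rule: less_induct)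
  case less
  let ?f = "monomial u - monomial v :: ('v \<times> 'v, 'k) mpoly"
  consider "u = v" | "primitive_binomial (toric_ideal D w) ?f"
    | "u \<noteq> v" "\<not> primitive_binomial (toric_ideal D w) ?f" by blast
  then show ?case
  proof cases
    case 1
    then show ?thesis using ideal_poly_ringD(1)[OF J] by simp
  next
    case 2
    then show ?thesis by (rule prim)
  next
    case 3
    then have "?f \<noteq> 0" by simp
    with 3 obtain a b where ab: "(monomial a - monomial b :: ('v \<times> 'v, 'k) mpoly) \<in> toric_ideal D w"
        "(monomial a - monomial b :: ('v \<times> 'v, 'k) mpoly) \<noteq> 0"
        "(monomial a - monomial b :: ('v \<times> 'v, 'k) mpoly) \<noteq> ?f"
        "(monomial a :: ('v \<times> 'v, 'k) mpoly) dvd monomial u"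
        "(monomial b :: ('v \<times> 'v, 'k) mpoly) dvd monomial v"
      using less.prems unfolding primitive_binomial_def by blast
    then obtain c d where cd: "u = a + c" "v = b + d" unfolding monomial_dvd_iff by blast
    have "a \<noteq> b" using ab(2) by auto
    have keys: "Poly_Mapping.keys m \<subseteq> parcs D" if "m \<in> {a, b, c, d}" for m
      using less.prems that \<open>u \<noteq> v\<close> by (auto simp: binomial_in_toric_ideal_iff cd keys_add_nat)
    \<comment> \<open>The witness differs from the binomial, so it is strictly smaller.\<close>
    have "c \<noteq> 0 \<or> d \<noteq> 0" using ab(3) cd by auto
    then have "exponent_size a + exponent_size b < exponent_size u + exponent_size v"
      unfolding cd exponent_size_add using exponent_size_eq_0_iff[of c] exponent_size_eq_0_iff[of d]
      by linarith
    then have abJ: "monomial a - monomial b \<in> J" using ab(1) by (rule less.hyps)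
    \<comment> \<open>The witness is not constant, so the complementary binomial is strictly smaller
      too.\<close>
    have "a \<noteq> 0 \<or> b \<noteq> 0" using \<open>a \<noteq> b\<close> by auto
    then have size: "exponent_size c + exponent_size d < exponent_size u + exponent_size v"
      unfolding cd exponent_size_add using exponent_size_eq_0_iff[of a] exponent_size_eq_0_iff[of b]
      by linarith
    have "toric_degree w c = toric_degree w d"
      using less.prems \<open>u \<noteq> v\<close> ab(1) \<open>a \<noteq> b\<close>
      by (auto simp: binomial_in_toric_ideal_iff cd toric_degree_add)
    then have "(monomial c - monomial d :: ('v \<times> 'v, 'k) mpoly) \<in> toric_ideal D w"
      by (cases "c = d")
        (simp add: toric_ideal_iff poly_ring_zero_closed, simp add: binomial_in_toric_ideal_iff keys)
    then have cdJ: "monomial c - monomial d \<in> J" using size less.hyps by blast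
    have closed: "(monomial m :: ('v \<times> 'v, 'k) mpoly) \<in> carrier (poly_ring (parcs D))"
      if "m \<in> {a, b, c, d}" for m
      using keys[OF that] by (simp add: carrier_poly_ring)
    have "monomial c * (monomial a - monomial b) + monomial b * (monomial c - monomial d) \<in> J"
      using ideal_poly_ringD(3)[OF J abJ closed[of c]]
        ideal_poly_ringD(3)[OF J cdJ closed[of b]] by (simp add: ideal_poly_ringD(2)[OF J])
    then show ?thesis by (simp add: cd monomial_add algebra_simps)
  qed
qed

section \<open>Graver elements are indispensable\<close>

text \<open>A common variable could be cancelled from both terms: degrees are additive, so the
  quotient stays in the ideal and contradicts minimality.\<close>

lemma primitive_binomial_disjoint:
  assumes "(monomial u - monomial v :: ('v \<times> 'v, 'k::field) mpoly) \<in> toric_ideal D w" "u \<noteq> v"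
    and prim: "\<And>a b. (monomial a - monomial b :: ('v \<times> 'v, 'k) mpoly) \<in> toric_ideal D w \<Longrightarrow> a \<noteq> b \<Longrightarrow>
      \<exists>d. u = a + d \<Longrightarrow> \<exists>d. v = b + d \<Longrightarrow>
      (monomial a - monomial b :: ('v \<times> 'v, 'k) mpoly) = monomial u - monomial v"
  shows "Poly_Mapping.lookup u e = 0 \<or> Poly_Mapping.lookup v e = 0"
proof (rule ccontr)
  assume pos: "\<not> ?thesis"
  define s :: "'v \<times> 'v \<Rightarrow>\<^sub>0 nat" where "s = Poly_Mapping.single e 1"
  have "\<exists>d. u = s + d" "\<exists>d. v = s + d"
    using pos by (auto simp: exponent_le_iff s_def lookup_single when_def)
  then obtain a b where ab: "u = a + s" "v = b + s" by (metis add.commute)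
  then have "a \<noteq> b" using \<open>u \<noteq> v\<close> by auto
  have "(monomial a - monomial b :: ('v \<times> 'v, 'k) mpoly) \<in> toric_ideal D w"
    using assms(1) \<open>u \<noteq> v\<close> \<open>a \<noteq> b\<close>
    by (auto simp: binomial_in_toric_ideal_iff ab toric_degree_add keys_add_nat)
  then have "(monomial a - monomial b :: ('v \<times> 'v, 'k) mpoly) = monomial u - monomial v"
    using \<open>a \<noteq> b\<close> ab by (intro prim) auto
  \<comment> \<open>Comparing supports forgets signs, so the swapped case remains; in characteristic
    2 it cannot be excluded by signs. The exponents of \<open>e\<close> refute both cases.\<close>
  then have "{a, b} = {u, v}"
    using keys_binomial[OF \<open>a \<noteq> b\<close>, where 'k = 'k] keys_binomial[OF \<open>u \<noteq> v\<close>, where 'k = 'k] by simp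
  then have "a = u \<or> a = v \<and> b = u" by (auto simp: doubleton_eq_iff)
  then have "Poly_Mapping.lookup a e = Poly_Mapping.lookup u e \<or>
      Poly_Mapping.lookup a e = Poly_Mapping.lookup v e \<and>
      Poly_Mapping.lookup b e = Poly_Mapping.lookup u e" by blast
  moreover have "Poly_Mapping.lookup u e = Poly_Mapping.lookup a e + 1"
      "Poly_Mapping.lookup v e = Poly_Mapping.lookup b e + 1"
    by (simp_all add: ab lookup_add s_def)
  ultimately show False by linarith
qed

section \<open>Sign patterns at vertices of degree two\<close>

context weighted_oriented_graph
begin

text \<open>Without loops no edge is both incoming and outgoing at \<open>x\<close>, so the degree
  counts the incident edges.\<close>

lemma degree_two_partner:
  assumes "e \<in> parcs D" "fst e = x \<or> snd e = x" "vertex_degree D x = 2"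
  obtains f where "f \<noteq> e" "{g \<in> parcs D. fst g = x \<or> snd g = x} = {e, f}"
proof -
  let ?i = "{g \<in> parcs D. snd g = x}" and ?o = "{g \<in> parcs D. fst g = x}"
  have "card (?i \<union> ?o) = card ?i + card ?o"
    by (rule card_Un_disjoint) (use pair_finite_arcs pair_no_loops in auto)
  also have "\<dots> = 2"
    using assms(3) by (simp add: vertex_degree_def in_degree_def out_degree_def in_arcs_def out_arcs_def)
  also have "?i \<union> ?o = {g \<in> parcs D. fst g = x \<or> snd g = x}" by auto
  finally obtain g h where "{g \<in> parcs D. fst g = x \<or> snd g = x} = {g, h}" "g \<noteq> h"
    by (auto simp: card_2_iff)
  moreover have "e \<in> {g \<in> parcs D. fst g = x \<or> snd g = x}" using assms(1,2) by simp
  ultimately show thesis using that[of g] that[of h] by (auto simp: insert_commute)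
qed

text \<open>Row \<open>x\<close> of the incidence matrix has just two nonzero entries, both
  positive, so a kernel vector that increases at \<open>e\<close> must decrease at \<open>f\<close>.
  The partner \<open>f\<close> depends on \<open>e\<close> alone and can serve several pairs
  \<open>a\<close>, \<open>b\<close>.\<close>

lemma opposite_sign_partner:
  assumes "\<forall>(x, y) \<in> parcs D. vertex_degree D x = 2 \<or> vertex_degree D y = 2" "e \<in> parcs D"
  obtains f where "\<And>a b. Poly_Mapping.keys a \<subseteq> parcs D \<Longrightarrow> Poly_Mapping.keys b \<subseteq> parcs D \<Longrightarrow>
    toric_degree w a = toric_degree w b \<Longrightarrow> Poly_Mapping.lookup a e < Poly_Mapping.lookup b e \<Longrightarrow>
    Poly_Mapping.lookup b f < Poly_Mapping.lookup a f"
proof -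
  obtain x where x: "fst e = x \<or> snd e = x" "vertex_degree D x = 2"
    using assms by (metis (mono_tags, lifting) case_prod_beta)
  obtain f where f: "f \<noteq> e" "{g \<in> parcs D. fst g = x \<or> snd g = x} = {e, f}"
    using degree_two_partner[OF assms(2) x] .
  \<comment> \<open>The entry of the incidence matrix in row \<open>x\<close> and column
    \<open>g\<close>.\<close>
  define c where "c g = of_bool (fst g = x) + of_bool (snd g = x) * w x" for g
  have "x \<in> pverts D" using x(1) assms(2) arc_fst_in_verts arc_snd_in_verts by blast
  have c: "c g > 0" if "g \<in> {e, f}" for g
  proof -
    have "fst g = x \<or> snd g = x" using that f(2) by blast
    then show ?thesis using weight_pos[OF \<open>x \<in> pverts D\<close>] by (auto simp: c_def)
  qed
  have deg: "Poly_Mapping.lookup (toric_degree w a) x =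
      Poly_Mapping.lookup a e * c e + Poly_Mapping.lookup a f * c f"
    if "Poly_Mapping.keys a \<subseteq> parcs D" for a
  proof -
    have "Poly_Mapping.lookup (toric_degree w a) x = (\<Sum>g\<in>parcs D. Poly_Mapping.lookup a g * c g)"
      using that unfolding c_def by (rule lookup_toric_degree[OF pair_finite_arcs])
    also have "\<dots> = (\<Sum>g\<in>{e, f}. Poly_Mapping.lookup a g * c g)"
      unfolding f(2)[symmetric] by (rule sum.mono_neutral_right) (auto simp: c_def)
    finally show ?thesis using f(1) by simp
  qed
  show thesis
  proof (rule that[of f])
    fix a b assume ab: "Poly_Mapping.keys a \<subseteq> parcs D" "Poly_Mapping.keys b \<subseteq> parcs D"
      "toric_degree w a = toric_degree w b" "Poly_Mapping.lookup a e < Poly_Mapping.lookup b e"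
    then have "Poly_Mapping.lookup a e * c e < Poly_Mapping.lookup b e * c e"
      using c by simp
    then have "Poly_Mapping.lookup b f * c f < Poly_Mapping.lookup a f * c f"
      using deg[OF ab(1)] deg[OF ab(2), folded ab(3)] by linarith
    then show "Poly_Mapping.lookup b f < Poly_Mapping.lookup a f" by simp
  qed
qed

text \<open>The decomposition \<open>u - v = (a - b) + (u + b - v - a)\<close> is semiconformal, hence conformal.\<close>

lemma semiconformal_imp_conformal:
  assumes deg2: "\<forall>(x, y) \<in> parcs D. vertex_degree D x = 2 \<or> vertex_degree D y = 2"
    and uv: "Poly_Mapping.keys u \<subseteq> parcs D" "Poly_Mapping.keys v \<subseteq> parcs D"
      "toric_degree w u = toric_degree w v"
      "\<And>e. Poly_Mapping.lookup u e = 0 \<or> Poly_Mapping.lookup v e = 0"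
    and ab: "Poly_Mapping.keys a \<subseteq> parcs D" "Poly_Mapping.keys b \<subseteq> parcs D"
      "toric_degree w a = toric_degree w b"
      "\<And>e. Poly_Mapping.lookup a e = 0 \<or> Poly_Mapping.lookup b e = 0"
    and le: "\<exists>d. u = a + d"
  shows "\<exists>d. v = b + d"
  unfolding exponent_le_iff
proof (rule allI, rule ccontr)
  fix e assume less: "\<not> Poly_Mapping.lookup b e \<le> Poly_Mapping.lookup v e"
  then have "e \<in> parcs D" using ab(2) by (auto simp: in_keys_iff)
  then obtain f where f: "\<And>a b. Poly_Mapping.keys a \<subseteq> parcs D \<Longrightarrow> Poly_Mapping.keys b \<subseteq> parcs D \<Longrightarrow>
      toric_degree w a = toric_degree w b \<Longrightarrow> Poly_Mapping.lookup a e < Poly_Mapping.lookup b e \<Longrightarrow>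
      Poly_Mapping.lookup b f < Poly_Mapping.lookup a f"
    using opposite_sign_partner[OF deg2] by blast
  have a0: "Poly_Mapping.lookup a e = 0" using ab(4)[of e] less by auto
  have "Poly_Mapping.lookup b f < Poly_Mapping.lookup a f"
    using f[OF ab(1-3)] a0 less by simp
  \<comment> \<open>The same partner is applied to the complementary vector: at \<open>e\<close>,
    \<open>v + a\<close> has the value of \<open>v\<close>, which is below that of
    \<open>b\<close>.\<close>
  moreover have "Poly_Mapping.lookup (u + b) f < Poly_Mapping.lookup (v + a) f"
    using uv(1-3) ab(1-3) a0 less
    by (intro f) (auto simp: keys_add_nat toric_degree_add lookup_add)
  moreover have "Poly_Mapping.lookup a f \<le> Poly_Mapping.lookup u f"
    using le by (auto simp: lookup_add)
  \<comment> \<open>At \<open>f\<close>, b < a \<le> u makes u positive, hence v = 0. Then u + b < v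
    + a reads u + b < a, against a \<le> u.\<close>
  ultimately show False using uv(4)[of f] by (auto simp: lookup_add)
qed

text \<open>Primitivity in terms of exponent vectors, with the disjointness of supports that
  conformality arguments rely on.\<close>

lemma primitive_binomial_toric_idealE:
  assumes "primitive_binomial (toric_ideal D w) (f :: ('v \<times> 'v, 'k::field) mpoly)"
  obtains u v where "f = monomial u - monomial v" "u \<noteq> v"
    "Poly_Mapping.keys u \<subseteq> parcs D" "Poly_Mapping.keys v \<subseteq> parcs D"
    "toric_degree w u = toric_degree w v"
    "\<And>e. Poly_Mapping.lookup u e = 0 \<or> Poly_Mapping.lookup v e = 0"
    "\<And>a b. (monomial a - monomial b :: ('v \<times> 'v, 'k) mpoly) \<in> toric_ideal D w \<Longrightarrow> a \<noteq> b \<Longrightarrow>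
      \<exists>d. u = a + d \<Longrightarrow> \<exists>d. v = b + d \<Longrightarrow> monomial a - monomial b = f"
proof -
  obtain u v where uv: "f = monomial u - monomial v" "f \<in> toric_ideal D w" "f \<noteq> 0"
    and prim: "\<And>g a b. g = monomial a - monomial b \<and> g \<in> toric_ideal D w \<and> g \<noteq> 0 \<and>
      (monomial a :: ('v \<times> 'v, 'k) mpoly) dvd monomial u \<and>
      (monomial b :: ('v \<times> 'v, 'k) mpoly) dvd monomial v \<Longrightarrow> g = f"
    using assms unfolding primitive_binomial_def by blast
  have min: "monomial a - monomial b = f"
    if "(monomial a - monomial b :: ('v \<times> 'v, 'k) mpoly) \<in> toric_ideal D w" "a \<noteq> b"
      "\<exists>d. u = a + d" "\<exists>d. v = b + d" for a b
    by (rule prim) (use that in \<open>simp add: monomial_dvd_iff\<close>)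
  have "u \<noteq> v" using uv by auto
  show thesis
  proof (rule that[OF uv(1) \<open>u \<noteq> v\<close>])
    show "Poly_Mapping.lookup u e = 0 \<or> Poly_Mapping.lookup v e = 0" for e
      by (rule primitive_binomial_disjoint[OF uv(2)[unfolded uv(1)] \<open>u \<noteq> v\<close>])
        (fold uv(1), rule min)
  qed (use uv(2) min in \<open>simp_all add: uv(1) binomial_in_toric_ideal_iff[OF \<open>u \<noteq> v\<close>]\<close>)
qed

text \<open>Once a term of \<open>t\<close> divides \<open>u\<close>, conformality makes the other
  term of \<open>t\<close> divide \<open>v\<close>, and minimality of \<open>f\<close> applies. The
  sign records which term of \<open>t\<close> divides \<open>u\<close>.\<close>

lemma primitive_binomial_indispensable_term:
  assumes deg2: "\<forall>(x, y) \<in> parcs D. vertex_degree D x = 2 \<or> vertex_degree D y = 2"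
    and f: "primitive_binomial (toric_ideal D w) (f :: ('v \<times> 'v, 'k::field) mpoly)"
  obtains u where "u \<in> Poly_Mapping.keys f"
    "\<And>t m. primitive_binomial (toric_ideal D w) (t :: ('v \<times> 'v, 'k) mpoly) \<Longrightarrow>
      m \<in> Poly_Mapping.keys t \<Longrightarrow> \<exists>d. u = m + d \<Longrightarrow> t = f \<or> t = - f"
proof (rule primitive_binomial_toric_idealE[OF f])
  fix u v
  assume uv: "f = monomial u - monomial v" "u \<noteq> v"
    "Poly_Mapping.keys u \<subseteq> parcs D" "Poly_Mapping.keys v \<subseteq> parcs D"
    "toric_degree w u = toric_degree w v"
    "\<And>e. Poly_Mapping.lookup u e = 0 \<or> Poly_Mapping.lookup v e = 0"
    "\<And>a b. (monomial a - monomial b :: ('v \<times> 'v, 'k) mpoly) \<in> toric_ideal D w \<Longrightarrow> a \<noteq> b \<Longrightarrow>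
      \<exists>d. u = a + d \<Longrightarrow> \<exists>d. v = b + d \<Longrightarrow> monomial a - monomial b = f"
  show thesis
  proof (rule that[of u])
    show "u \<in> Poly_Mapping.keys f" using uv(1,2) by (simp add: keys_binomial)
    fix t :: "('v \<times> 'v, 'k) mpoly" and m
    assume t: "primitive_binomial (toric_ideal D w) t" "m \<in> Poly_Mapping.keys t" "\<exists>d. u = m + d"
    show "t = f \<or> t = - f"
    proof (rule primitive_binomial_toric_idealE[OF t(1)])
      fix a b
      assume ab: "t = monomial a - monomial b" "a \<noteq> b"
        "Poly_Mapping.keys a \<subseteq> parcs D" "Poly_Mapping.keys b \<subseteq> parcs D"
        "toric_degree w a = toric_degree w b"
        "\<And>e. Poly_Mapping.lookup a e = 0 \<or> Poly_Mapping.lookup b e = 0"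
      have ba: "Poly_Mapping.lookup b e = 0 \<or> Poly_Mapping.lookup a e = 0" for e
        using ab(6)[of e] by (rule disj_commute[THEN iffD1])
      \<comment> \<open>Both orientations are needed, as \<open>m\<close> may be either term of
        \<open>t\<close>.\<close>
      have I: "(monomial a - monomial b :: ('v \<times> 'v, 'k) mpoly) \<in> toric_ideal D w"
          "(monomial b - monomial a :: ('v \<times> 'v, 'k) mpoly) \<in> toric_ideal D w"
        using ab by (auto simp: binomial_in_toric_ideal_iff)
      have "m = a \<or> m = b" using t(2) ab(1,2) by (simp add: keys_binomial)
      then show ?thesis
      proof
        assume "m = a"
        with t(3) have u: "\<exists>d. u = a + d" by simp
        then have "\<exists>d. v = b + d" by (rule semiconformal_imp_conformal[OF deg2 uv(3-6) ab(3-6)])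
        with u have "monomial a - monomial b = f" by (rule uv(7)[OF I(1) ab(2)])
        then show ?thesis using ab(1) by simp
      next
        assume "m = b"
        with t(3) have u: "\<exists>d. u = b + d" by simp
        then have "\<exists>d. v = a + d"
          by (rule semiconformal_imp_conformal[OF deg2 uv(3-6) ab(4,3) ab(5)[symmetric] ba])
        with u have "monomial b - monomial a = f" by (rule uv(7)[OF I(2) ab(2)[symmetric]])
        then show ?thesis using ab(1) by auto
      qed
    qed
  qed
qed

end

theorem corollary3p9:
  fixes D :: "'v pair_pre_digraph" and w :: "'v \<Rightarrow> nat"
  assumes "weighted_oriented_graph D w"
    and "\<forall>(x, y) \<in> parcs D. vertex_degree D x = 2 \<or> vertex_degree D y = 2"
  shows "strongly_robust (parcs D) (toric_ideal D w :: ('v \<times> 'v, 'k::field) mpoly set)"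
  unfolding strongly_robust_def minimal_generating_set_def
proof (intro allI impI conjI)
  interpret weighted_oriented_graph D w by (rule assms(1))
  let ?R = "poly_ring (parcs D) :: ('v \<times> 'v, 'k) mpoly ring"
  let ?I = "toric_ideal D w :: ('v \<times> 'v, 'k) mpoly set"
  interpret R: cring ?R by (rule cring_poly_ring)
  fix S assume "graver_basis ?I S"
  then have S: "\<And>f. f \<in> S \<Longrightarrow> primitive_binomial ?I f"
    and ex1: "\<And>f. primitive_binomial ?I f \<Longrightarrow> \<exists>!g. g \<in> S \<and> (g = f \<or> g = - f)"
    unfolding graver_basis_def by auto
  have SI: "S \<subseteq> ?I" using S unfolding primitive_binomial_def by blast
  show SR: "S \<subseteq> carrier ?R" using SI by (auto simp: toric_ideal_iff)
  show "Idl\<^bsub>?R\<^esub> S = ?I"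
  proof
    show "Idl\<^bsub>?R\<^esub> S \<subseteq> ?I" by (rule R.genideal_minimal[OF toric_ideal_ideal SI])
    have J: "ideal (Idl\<^bsub>?R\<^esub> S) ?R" by (rule R.genideal_ideal[OF SR])
    \<comment> \<open>Only one of \<open>f\<close> and \<open>- f\<close> need lie in
      \<open>S\<close>; multiplication by -1 reaches the other.\<close>
    have "f \<in> Idl\<^bsub>?R\<^esub> S" if f: "primitive_binomial ?I f" for f
    proof -
      obtain g where g: "g \<in> S" "g = f \<or> g = - f" using ex1[OF f] by blast
      have "g \<in> Idl\<^bsub>?R\<^esub> S" using R.genideal_self[OF SR] g(1) by blast
      moreover have "- 1 \<in> carrier ?R" by (intro poly_ring_uminus_closed poly_ring_one_closed)
      ultimately have "- g \<in> Idl\<^bsub>?R\<^esub> S" using ideal_poly_ringD(3)[OF J, of g "- 1"] by simp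
      then show ?thesis using g(2) \<open>g \<in> Idl\<^bsub>?R\<^esub> S\<close> by auto
    qed
    then show "?I \<subseteq> Idl\<^bsub>?R\<^esub> S"
      by (intro toric_ideal_subset[OF J] binomial_in_ideal_of_primitive[OF J])
  qed
  fix T assume "T \<subset> S"
  then obtain f where f: "f \<in> S" "f \<notin> T" by blast
  obtain u where u: "u \<in> Poly_Mapping.keys f"
    "\<And>t m. primitive_binomial ?I t \<Longrightarrow> m \<in> Poly_Mapping.keys t \<Longrightarrow> \<exists>d. u = m + d \<Longrightarrow> t = f \<or> t = - f"
    using primitive_binomial_indispensable_term[OF assms(2) S[OF f(1)]] by blast
  \<comment> \<open>This ideal will contain \<open>T\<close> but not \<open>f\<close>, which has the
    term \<open>u\<close>.\<close>
  let ?J = "{p \<in> carrier ?R. \<forall>m\<in>Poly_Mapping.keys p. \<not> (\<exists>d. u = m + d)}"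
  have "T \<subseteq> ?J"
  proof
    fix t assume t: "t \<in> T"
    then have "t \<in> S" "t \<noteq> f" using \<open>T \<subset> S\<close> f(2) by auto
    \<comment> \<open>As \<open>f\<close> is in \<open>S\<close>, uniqueness in the Graver basis
      leaves no other element equal to \<open>- f\<close>.\<close>
    then have "\<not> (t = f \<or> t = - f)" using ex1[OF S[OF f(1)]] f(1) by blast
    then show "t \<in> ?J" using u(2)[OF S[OF \<open>t \<in> S\<close>]] \<open>t \<in> S\<close> SR by blast
  qed
  then have "Idl\<^bsub>?R\<^esub> T \<subseteq> ?J" by (rule R.genideal_minimal[OF monomial_ideal])
  moreover have "f \<notin> ?J" using u(1) by force
  ultimately show "Idl\<^bsub>?R\<^esub> T \<noteq> ?I" using f(1) SI by blast
qed

end
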